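(* Let $d\ge1$ be an integer. If every cosimple zonotope with generators in $\mathbb{Z}^{d-1}$ has covering radius at most $\frac{d-1}{d+1}$, then every cosimple zonotope $Z$ with generators in $\mathbb{Z}^d$ and covering radius $\mu(Z)>\frac{d}{d+2}$ contains at most $\binom{d+2}{2}^d$ points of $\mathbb{Z}^d$.
   Context: A finite collection of vectors $\mathbf u_1,\dots,\mathbf u_n\in\mathbb{Z}^d$ that linearly spans $\mathbb{R}^d$ is called cosimple if there is a linear dependence $\sum_i\lambda_i\mathbf u_i=\mathbf 0$ whose coefficients $\lambda_i$ are all non-zero and have pairwise different absolute values. A cosimple zonotope is a zonotope $\sum_{i=1}^n[\mathbf 0,\mathbf u_i]$ generated by a cosimple collection. The covering radius of a convex body $M\subseteq\mathbb{R}^d$ is $\mu(M)=\min\{\rho>0:\rho M+\mathbb{Z}^d=\mathbb{R}^d\}$. *)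

theory Defs
  imports "Jordan_Normal_Form.VS_Connect"
begin

(* Points of R^d are real vectors in carrier_vec d, so that R^d and R^(d-1), including R^0,
   live in the same type.  A collection u_1, ..., u_n is a family u indexed by {..<n}
   (repetitions and zero vectors are allowed). *)

abbreviation real_of_int_vec :: "int vec \<Rightarrow> real vec" where
  "real_of_int_vec \<equiv> map_vec real_of_int"

definition integer_points :: "nat \<Rightarrow> real vec set" where
  "integer_points d = real_of_int_vec ` carrier_vec d"

definition spans_real_space :: "nat \<Rightarrow> nat \<Rightarrow> (nat \<Rightarrow> int vec) \<Rightarrow> bool" where
  "spans_real_space d n u \<longleftrightarrow>
     LinearCombinations.module.span class_ring (module_vec TYPE(real) d)
       ((\<lambda>i. real_of_int_vec (u i)) ` {..<n}) = carrier_vec d"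

definition cosimple :: "nat \<Rightarrow> nat \<Rightarrow> (nat \<Rightarrow> int vec) \<Rightarrow> bool" where
  "cosimple d n u \<longleftrightarrow>
     (\<forall>i<n. u i \<in> carrier_vec d) \<and>
     spans_real_space d n u \<and>
     (\<exists>c :: nat \<Rightarrow> real.
        finsum_vec TYPE(real) d (\<lambda>i. c i \<cdot>\<^sub>v real_of_int_vec (u i)) {..<n} = 0\<^sub>v d \<and>
        (\<forall>i<n. c i \<noteq> 0) \<and>
        (\<forall>i<n. \<forall>j<n. i \<noteq> j \<longrightarrow> \<bar>c i\<bar> \<noteq> \<bar>c j\<bar>))"

(* The Minkowski sum of the segments [0, u i] = {t u i | 0 \<le> t \<le> 1}. *)
definition zonotope :: "nat \<Rightarrow> nat \<Rightarrow> (nat \<Rightarrow> int vec) \<Rightarrow> real vec set" where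
  "zonotope d n u =
     {finsum_vec TYPE(real) d (\<lambda>i. t i \<cdot>\<^sub>v real_of_int_vec (u i)) {..<n} | t :: nat \<Rightarrow> real.
        \<forall>i<n. 0 \<le> t i \<and> t i \<le> 1}"

definition cosimple_zonotope :: "nat \<Rightarrow> real vec set \<Rightarrow> bool" where
  "cosimple_zonotope d Z \<longleftrightarrow> (\<exists>n u. cosimple d n u \<and> Z = zonotope d n u)"

(* For d \<ge> 1 and a convex body M with nonempty interior the infimum is attained, so it is the
   usual minimum.  For d = 0 every \<rho> > 0 qualifies, there is no minimum, and the value is 0. *)
definition covering_radius :: "nat \<Rightarrow> real vec set \<Rightarrow> real" where
  "covering_radius d M =
     Inf {\<rho>. 0 < \<rho> \<and>
        {\<rho> \<cdot>\<^sub>v x + z | x z. x \<in> M \<and> z \<in> integer_points d} = carrier_vec d}"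

end

theory Submission
  imports Defs
begin

text \<open>Put \<open>N = (d + 2) choose 2\<close>.  If a cosimple zonotope \<open>Z\<close> had more than \<open>N ^ d\<close> lattice
  points, two of them would be congruent modulo \<open>N\<close>, so \<open>Z\<close> would contain a segment from \<open>a\<close>
  to \<open>a + N w\<close> with \<open>w\<close> a nonzero integer vector.  Projecting the lattice along \<open>w\<close> sends \<open>Z\<close> to
  a cosimple zonotope in dimension \<open>d - 1\<close>, which has covering radius at most
  \<open>(d - 1) / (d + 1)\<close>, while \<open>(1 / N) Z\<close> contains a translate of the segment \<open>[0, w]\<close> and
  hence covers the fibres of the projection modulo the lattice.  Therefore the covering radius of
  \<open>Z\<close> is at most \<open>(d - 1) / (d + 1) + 1 / N = d / (d + 2)\<close>.\<close>

section \<open>Reduction of an integer vector by unimodular matrices\<close>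

lemma mult_mat_vec_index_sum:
  assumes "A \<in> carrier_mat r n" "w \<in> carrier_vec n" "i < r"
  shows "(A *\<^sub>v w) $ i = (\<Sum>j<n. A $$ (i,j) * w $ j)"
  using assms by (simp add: scalar_prod_def atLeast0LessThan)

lemma addrow_mat_mult_vec_index:
  fixes w :: "'a :: comm_ring_1 vec"
  assumes w: "w \<in> carrier_vec n" and i: "i < n" and l: "l < n"
  shows "(addrow_mat n a k l *\<^sub>v w) $ i = (if i = k then w $ i + a * w $ l else w $ i)"
proof -
  have "(addrow_mat n a k l *\<^sub>v w) $ i = (\<Sum>j<n. addrow_mat n a k l $$ (i,j) * w $ j)"
    by (rule mult_mat_vec_index_sum[OF _ w i]) simp
  also have "\<dots> =
      (\<Sum>j<n. (if j = i then w $ j else 0) + (if j = l then (if i = k then a * w $ j else 0) else 0))"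
    using i by (intro sum.cong) (auto simp: algebra_simps)
  also have "\<dots> = (if i = k then w $ i + a * w $ l else w $ i)"
    using i l by (simp add: sum.distrib)
  finally show ?thesis .
qed

lemma swaprows_mat_mult_vec_index:
  fixes w :: "'a :: comm_ring_1 vec"
  assumes w: "w \<in> carrier_vec n" and i: "i < n" and "k < n" "l < n"
  shows "(swaprows_mat n k l *\<^sub>v w) $ i = w $ (if i = k then l else if i = l then k else i)"
proof -
  let ?p = "if i = k then l else if i = l then k else i"
  have "(swaprows_mat n k l *\<^sub>v w) $ i = (\<Sum>j<n. swaprows_mat n k l $$ (i,j) * w $ j)"
    by (rule mult_mat_vec_index_sum[OF _ w i]) simp
  also have "\<dots> = (\<Sum>j<n. if j = ?p then w $ j else 0)"
    using assms by (intro sum.cong) auto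
  also have "\<dots> = w $ ?p"
    using assms by (subst sum.delta) auto
  finally show ?thesis .
qed

lemma inverse_pair_mult:
  assumes "U \<in> carrier_mat n n" "V \<in> carrier_mat n n" "E \<in> carrier_mat n n" "F \<in> carrier_mat n n"
    and "U * V = 1\<^sub>m n" "E * F = 1\<^sub>m n"
  shows "(U * E) * (F * V) = (1\<^sub>m n :: 'a :: comm_ring_1 mat)"
proof -
  have "(U * E) * (F * V) = U * ((E * F) * V)"
    using assms(1-4) by (smt (verit) assoc_mult_mat mult_carrier_mat)
  then show ?thesis using assms by simp
qed

text \<open>Euclid's algorithm by elementary row operations, as an induction on the sum of the
  absolute values of the entries. While two entries are nonzero, a row addition \<open>E\<close>
  lowers this sum; once at most one is left, a swap moves it to position \<open>m\<close>. The
  inverse \<open>V\<close> is built up alongside \<open>U\<close>, so unimodularity is available as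
  a two-sided integer inverse.\<close>

lemma unimodular_reduction:
  fixes w :: "int vec"
  assumes "w \<in> carrier_vec (Suc m)"
  shows "\<exists>U V. U \<in> carrier_mat (Suc m) (Suc m) \<and> V \<in> carrier_mat (Suc m) (Suc m) \<and>
    U * V = 1\<^sub>m (Suc m) \<and> V * U = 1\<^sub>m (Suc m) \<and> (\<forall>i<m. (U *\<^sub>v w) $ i = 0)"
  using assms
proof (induction w rule: measure_induct_rule[of "\<lambda>w. \<Sum>i<Suc m. nat \<bar>w $ i\<bar>"])
  case (less w)
  let ?d = "Suc m"
  show ?case
  proof (cases "\<exists>i<?d. \<exists>j<?d. i \<noteq> j \<and> w $ i \<noteq> 0 \<and> w $ j \<noteq> 0")
    case True
    then obtain i j where ij: "i < ?d" "j < ?d" "i \<noteq> j" "w $ i \<noteq> 0" "w $ j \<noteq> 0"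
      and le: "\<bar>w $ j\<bar> \<le> \<bar>w $ i\<bar>"
      by (metis linorder_le_cases)
    \<comment> \<open>With this sign \<open>a * w $ j\<close> points against \<open>w $ i\<close>,
      so entry \<open>i\<close> drops in absolute value by exactly the absolute value of
      \<open>w $ j\<close>, which is positive and at most that of \<open>w $ i\<close>.\<close>
    define a where "a = - (sgn (w $ i) * sgn (w $ j))"
    define E where "E = addrow_mat ?d a i j"
    define F where "F = addrow_mat ?d (- a) i j"
    have E: "E \<in> carrier_mat ?d ?d" and F: "F \<in> carrier_mat ?d ?d"
      unfolding E_def F_def by auto
    have EF: "E * F = 1\<^sub>m ?d" unfolding E_def F_def using ij by (simp add: addrow_mat_inv)
    have FE: "F * E = 1\<^sub>m ?d"
      using addrow_mat_inv[of i ?d j "- a"] ij unfolding E_def F_def by simp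
    have Ew: "E *\<^sub>v w \<in> carrier_vec ?d" using E less.prems by simp
    have idx: "(E *\<^sub>v w) $ l = (if l = i then w $ l + a * w $ j else w $ l)" if "l < ?d" for l
      unfolding E_def by (rule addrow_mat_mult_vec_index[OF less.prems that ij(2)])
    have small: "\<bar>w $ i + a * w $ j\<bar> < \<bar>w $ i\<bar>"
      using ij le unfolding a_def by (auto simp: sgn_if split: if_splits)
    have "(\<Sum>l<?d. nat \<bar>(E *\<^sub>v w) $ l\<bar>) < (\<Sum>l<?d. nat \<bar>w $ l\<bar>)"
    proof (rule sum_strict_mono_ex1)
      show "\<forall>l\<in>{..<?d}. nat \<bar>(E *\<^sub>v w) $ l\<bar> \<le> nat \<bar>w $ l\<bar>" using idx small by auto
      show "\<exists>l\<in>{..<?d}. nat \<bar>(E *\<^sub>v w) $ l\<bar> < nat \<bar>w $ l\<bar>" using idx small ij by force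
    qed simp
    from less.IH[OF this Ew] obtain U V where
      UV: "U \<in> carrier_mat ?d ?d" "V \<in> carrier_mat ?d ?d" "U * V = 1\<^sub>m ?d" "V * U = 1\<^sub>m ?d"
      and z: "\<forall>i<m. (U *\<^sub>v (E *\<^sub>v w)) $ i = 0" by blast
    have "U * E *\<^sub>v w = U *\<^sub>v (E *\<^sub>v w)" using UV E less.prems by (simp add: assoc_mult_mat_vec)
    with z inverse_pair_mult[OF UV(1,2) E F UV(3) EF] inverse_pair_mult[OF F E UV(2,1) FE UV(4)] UV E F
    show ?thesis by (intro exI[of _ "U * E"] exI[of _ "F * V"]) auto
  next
    case False
    \<comment> \<open>\<open>j\<close> is the position of the only nonzero entry; if
      \<open>w\<close> is zero, any index serves.\<close>
    then obtain j where j: "j < ?d" and z: "\<And>i. i < ?d \<Longrightarrow> i \<noteq> j \<Longrightarrow> w $ i = 0"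
      by (metis zero_less_Suc)
    let ?S = "swaprows_mat ?d j m :: int mat"
    have "?S * ?S = 1\<^sub>m ?d" using j by (simp add: swaprows_mat_inv)
    moreover have "(?S *\<^sub>v w) $ i = 0" if "i < m" for i
      using swaprows_mat_mult_vec_index[OF less.prems, of i j m] that j z by auto
    ultimately show ?thesis by (intro exI[of _ ?S]) auto
  qed
qed

section \<open>Integer projections along a lattice vector\<close>

lemma mult_mat_vec_last:
  fixes A :: "'a :: comm_ring_1 mat"
  assumes "A \<in> carrier_mat r (Suc m)" "y \<in> carrier_vec (Suc m)" "\<And>i. i < m \<Longrightarrow> y $ i = 0"
  shows "A *\<^sub>v y = y $ m \<cdot>\<^sub>v col A m"
  using assms by (intro eq_vecI) (auto simp: scalar_prod_def mult.commute)

abbreviation real_of_int_mat :: "int mat \<Rightarrow> real mat" where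
  "real_of_int_mat \<equiv> map_mat real_of_int"

text \<open>Take \<open>U\<close> and \<open>V\<close> from the reduction of \<open>w\<close>;
  \<open>P\<close> is the first \<open>m\<close> rows of \<open>U\<close> and \<open>Q\<close> the
  first \<open>m\<close> columns of \<open>V\<close>, so \<open>P * Q\<close> is the upper left
  block of \<open>U * V = 1\<close>. If \<open>P\<close> kills \<open>x\<close>, then
  \<open>U\<close> maps \<open>x\<close> to a multiple of the last unit vector, so \<open>x\<close>
  is a multiple of the last column of \<open>V\<close>, and \<open>w\<close> is
  \<open>k \<noteq> 0\<close> times that column. Since \<open>Q\<close> is integral,
  \<open>P\<close> maps the integer vectors onto those of dimension \<open>m\<close>.\<close>

lemma projection_along_integer_vector:
  fixes w :: "int vec"
  assumes w: "w \<in> carrier_vec (Suc m)" "w \<noteq> 0\<^sub>v (Suc m)"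
  obtains P Q where "P \<in> carrier_mat m (Suc m)" "Q \<in> carrier_mat (Suc m) m" "P * Q = 1\<^sub>m m"
    "\<And>x. x \<in> carrier_vec (Suc m) \<Longrightarrow> real_of_int_mat P *\<^sub>v x = 0\<^sub>v m \<Longrightarrow>
       \<exists>s. x = s \<cdot>\<^sub>v real_of_int_vec w"
proof -
  let ?d = "Suc m"
  obtain U V where UV: "U \<in> carrier_mat ?d ?d" "V \<in> carrier_mat ?d ?d" "U * V = 1\<^sub>m ?d" "V * U = 1\<^sub>m ?d"
      and z: "\<forall>i<m. (U *\<^sub>v w) $ i = 0" using unimodular_reduction[OF w(1)] by blast
  define P where "P = mat m ?d (\<lambda>(i,j). U $$ (i,j))"
  define Q where "Q = mat ?d m (\<lambda>(i,j). V $$ (i,j))"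
  define k where "k = (U *\<^sub>v w) $ m"
  have "w = V *\<^sub>v (U *\<^sub>v w)"
    using UV w by (simp add: assoc_mult_mat_vec[symmetric])
  also have "\<dots> = k \<cdot>\<^sub>v col V m"
    unfolding k_def using UV w z by (intro mult_mat_vec_last) auto
  finally have wk: "w = k \<cdot>\<^sub>v col V m" .
  have k0: "k \<noteq> 0"
  proof
    assume "k = 0"
    then have "w = 0\<^sub>v ?d" using wk UV by auto
    with w show False by simp
  qed
  have PQ: "P * Q = 1\<^sub>m m"
  proof (rule eq_matI)
    fix i j assume ij: "i < dim_row (1\<^sub>m m)" "j < dim_col (1\<^sub>m m)"
    then have "row P i = row U i" "col Q j = col V j"
      using UV by (auto simp: P_def Q_def intro!: eq_vecI)
    then have "(P * Q) $$ (i,j) = (U * V) $$ (i,j)"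
      using ij UV(1,2) by (simp add: P_def Q_def)
    then show "(P * Q) $$ (i,j) = 1\<^sub>m m $$ (i,j)" using ij UV(3) by simp
qed (auto simp: P_def Q_def)
  let ?U = "real_of_int_mat U" and ?V = "real_of_int_mat V"
  have VU: "?V * ?U = 1\<^sub>m ?d"
    using UV of_int_hom.mat_hom_mult[of V ?d ?d U ?d, symmetric] by (simp add: of_int_hom.mat_hom_one)
  have ker: "\<exists>s. x = s \<cdot>\<^sub>v real_of_int_vec w"
    if x: "x \<in> carrier_vec ?d" and Px: "real_of_int_mat P *\<^sub>v x = 0\<^sub>v m" for x
  proof -
    have Ux: "(?U *\<^sub>v x) $ i = 0" if i: "i < m" for i
    proof -
      have "(?U *\<^sub>v x) $ i = (real_of_int_mat P *\<^sub>v x) $ i"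
        using UV x i by (auto simp: P_def scalar_prod_def)
      then show ?thesis using Px i by simp
    qed
    have "x = ?V *\<^sub>v (?U *\<^sub>v x)"
      using UV x VU by (simp add: assoc_mult_mat_vec[symmetric])
    also have "\<dots> = (?U *\<^sub>v x) $ m \<cdot>\<^sub>v col ?V m"
      using UV x Ux by (intro mult_mat_vec_last) auto
    also have "\<dots> = ((?U *\<^sub>v x) $ m / k) \<cdot>\<^sub>v real_of_int_vec w"
      using UV k0 unfolding wk by (intro eq_vecI) auto
    finally show ?thesis by blast
  qed
  show thesis by (rule that[of P Q]) (use PQ ker in \<open>auto simp: P_def Q_def\<close>)
qed

section \<open>Combinations of the generators: common form of span, dependence and zonotope\<close>

definition combination :: "nat \<Rightarrow> nat \<Rightarrow> (nat \<Rightarrow> int vec) \<Rightarrow> (nat \<Rightarrow> real) \<Rightarrow> real vec" where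
  "combination d n u t = finsum_vec TYPE(real) d (\<lambda>i. t i \<cdot>\<^sub>v real_of_int_vec (u i)) {..<n}"

lemma combination_carrier:
  assumes "u \<in> {..<n} \<rightarrow> carrier_vec d"
  shows "combination d n u t \<in> carrier_vec d"
  unfolding combination_def by (rule finsum_vec_closed) (use assms in auto)

lemma combination_dim:
  assumes "u \<in> {..<n} \<rightarrow> carrier_vec d"
  shows "dim_vec (combination d n u t) = d"
  using combination_carrier[OF assms] by (rule carrier_vecD)

lemma combination_index:
  assumes u: "u \<in> {..<n} \<rightarrow> carrier_vec d" and j: "j < d"
  shows "combination d n u t $ j = (\<Sum>i<n. t i * real_of_int (u i $ j))"
proof -
  have "dim_vec (u i) = d" if "i < n" for i using u that by (auto simp: Pi_iff)
  moreover have "combination d n u t $ j = (\<Sum>i<n. (t i \<cdot>\<^sub>v real_of_int_vec (u i)) $ j)"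
    unfolding combination_def by (rule index_finsum_vec) (use u j in auto)
  ultimately show ?thesis using j by simp
qed

lemma combination_eqI:
  assumes u: "u \<in> {..<n} \<rightarrow> carrier_vec d" and x: "x \<in> carrier_vec d"
    and "\<And>j. j < d \<Longrightarrow> x $ j = (\<Sum>i<n. t i * real_of_int (u i $ j))"
  shows "x = combination d n u t"
  using assms carrier_vecD[OF combination_carrier[OF u]]
  by (intro eq_vecI) (auto simp: combination_index[OF u])

lemma combination_add:
  assumes u: "u \<in> {..<n} \<rightarrow> carrier_vec d"
  shows "combination d n u s + combination d n u t = combination d n u (\<lambda>i. s i + t i)"
  using combination_carrier[OF u]
  by (intro combination_eqI[OF u])
    (auto simp: combination_dim[OF u] combination_index[OF u] sum.distrib distrib_right)

lemma combination_smult: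
  assumes u: "u \<in> {..<n} \<rightarrow> carrier_vec d"
  shows "r \<cdot>\<^sub>v combination d n u t = combination d n u (\<lambda>i. r * t i)"
  using combination_carrier[OF u]
  by (intro combination_eqI[OF u])
    (auto simp: combination_dim[OF u] combination_index[OF u] sum_distrib_left mult.assoc)

lemma combination_mult_mat_vec:
  assumes u: "u \<in> {..<n} \<rightarrow> carrier_vec d" and P: "P \<in> carrier_mat m d"
  shows "real_of_int_mat P *\<^sub>v combination d n u t = combination m n (\<lambda>i. P *\<^sub>v u i) t"
proof (rule combination_eqI)
  fix j assume j: "j < m"
  have "(real_of_int_mat P *\<^sub>v combination d n u t) $ j =
      (\<Sum>l<d. real_of_int_mat P $$ (j,l) * combination d n u t $ l)"
    by (rule mult_mat_vec_index_sum) (use P j combination_carrier[OF u] in auto)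
  also have "\<dots> = (\<Sum>l<d. \<Sum>i<n. t i * (P $$ (j,l) * real_of_int (u i $ l)))"
    using j P by (intro sum.cong) (auto simp: combination_index[OF u] sum_distrib_left algebra_simps)
  also have "\<dots> = (\<Sum>i<n. \<Sum>l<d. t i * (P $$ (j,l) * real_of_int (u i $ l)))"
    by (rule sum.swap)
  also have "\<dots> = (\<Sum>i<n. t i * real_of_int ((P *\<^sub>v u i) $ j))"
  proof (rule sum.cong)
    fix i assume "i \<in> {..<n}"
    then have "u i \<in> carrier_vec d" using u by auto
    then have "(P *\<^sub>v u i) $ j = (\<Sum>l<d. P $$ (j,l) * u i $ l)"
      using P j by (intro mult_mat_vec_index_sum)
    then show "(\<Sum>l<d. t i * (P $$ (j,l) * real_of_int (u i $ l))) = t i * real_of_int ((P *\<^sub>v u i) $ j)"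
      by (simp only: of_int_sum of_int_mult sum_distrib_left)
  qed simp
  finally show "(real_of_int_mat P *\<^sub>v combination d n u t) $ j =
      (\<Sum>i<n. t i * real_of_int ((P *\<^sub>v u i) $ j))" .
qed (use P combination_carrier[OF u] u in \<open>auto intro!: mult_mat_vec_carrier[OF P]\<close>)

text \<open>Passes from the span of the set of generators to coefficients on the indexed family, in
  which repetitions may occur. The combinations form a submodule containing every generator, which
  gives one inclusion; the other follows by induction on the set of summed indices.\<close>

lemma spans_real_space_iff:
  assumes u: "u \<in> {..<n} \<rightarrow> carrier_vec d"
  shows "spans_real_space d n u \<longleftrightarrow> (\<forall>x \<in> carrier_vec d. \<exists>t. x = combination d n u t)"
proof -
  interpret vec_space "TYPE(real)" d .
  let ?B = "(\<lambda>i. real_of_int_vec (u i)) ` {..<n}"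
  have B: "?B \<subseteq> carrier_vec d" using u by auto
  have sub: "submodule class_ring (range (combination d n u)) V"
  proof (unfold_locales, goal_cases)
    case 1
    then show ?case using combination_carrier[OF u] by auto
  next
    case (2 v w)
    then show ?case using combination_add[OF u] by auto
  next
    case 3
    have "0\<^sub>v d = combination d n u (\<lambda>i. 0)" using u by (intro combination_eqI) auto
    then show ?case by auto
  next
    case (4 c v)
    then show ?case using combination_smult[OF u] by auto
  qed
  have gen: "real_of_int_vec (u i) = combination d n u (\<lambda>j. if j = i then 1 else 0)" if i: "i < n" for i
  proof (rule combination_eqI[OF u])
    have ui: "u i \<in> carrier_vec d" using u i by auto
    then show "real_of_int_vec (u i) \<in> carrier_vec d" by simp
    show "real_of_int_vec (u i) $ j = (\<Sum>l<n. (if l = i then 1 else 0) * real_of_int (u l $ j))"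
      if "j < d" for j
    proof -
      have "(\<Sum>l<n. (if l = i then 1 else 0) * real_of_int (u l $ j)) =
          (\<Sum>l<n. if l = i then real_of_int (u l $ j) else 0)"
        by (intro sum.cong) auto
      then show ?thesis using ui that i by simp
    qed
  qed
  have "span ?B \<subseteq> range (combination d n u)"
    by (rule span_is_subset[OF _ sub]) (use gen in auto)
  moreover have "combination d n u t \<in> span ?B" for t
  proof -
    interpret S: submodule class_ring "span ?B" V using span_is_submodule B by simp
    have "finsum_vec TYPE(real) d (\<lambda>i. t i \<cdot>\<^sub>v real_of_int_vec (u i)) A \<in> span ?B"
      if "finite A" "A \<subseteq> {..<n}" for A
      using that
    proof (induction A rule: finite_induct)
      case empty
      then show ?case using S.zero_closed by simp
    next
      case (insert i A)
      have "real_of_int_vec (u i) \<in> span ?B" using insert.prems in_own_span[of ?B] B by auto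
      then have "t i \<cdot>\<^sub>v real_of_int_vec (u i) \<in> span ?B" using S.smult_closed[of "t i"] by simp
      moreover have "(\<lambda>i. t i \<cdot>\<^sub>v real_of_int_vec (u i)) \<in> insert i A \<rightarrow> carrier_vec d"
        using u insert.prems by auto
      ultimately show ?case using insert S.m_closed by (auto simp: finsum_insert)
    qed
    then show ?thesis by (simp add: combination_def)
  qed
  ultimately have "span ?B = range (combination d n u)" by auto
  then show ?thesis
    unfolding spans_real_space_def using combination_carrier[OF u] by auto
qed

lemma cosimple_iff:
  "cosimple d n u \<longleftrightarrow>
     (\<forall>i<n. u i \<in> carrier_vec d) \<and> (\<forall>x \<in> carrier_vec d. \<exists>t. x = combination d n u t) \<and>
     (\<exists>c. combination d n u c = 0\<^sub>v d \<and> (\<forall>i<n. c i \<noteq> 0) \<and>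
        (\<forall>i<n. \<forall>j<n. i \<noteq> j \<longrightarrow> \<bar>c i\<bar> \<noteq> \<bar>c j\<bar>))"
  unfolding cosimple_def using spans_real_space_iff[of u n d] by (auto simp: combination_def)

section \<open>Projections of cosimple families\<close>

lemma mult_right_inverse:
  assumes "P \<in> carrier_mat m d" "Q \<in> carrier_mat d m" "P * Q = 1\<^sub>m m" "y \<in> carrier_vec m"
  shows "P *\<^sub>v (Q *\<^sub>v y) = (y :: 'a :: comm_ring_1 vec)"
  using assms by (simp add: assoc_mult_mat_vec[symmetric])

text \<open>By linearity the same coefficients give a dependence of the images, so their being
  nonzero and of distinct absolute values carries over, even if images coincide or vanish. For
  spanning, a combination representing \<open>Q *\<^sub>v y\<close> is mapped by \<open>P\<close> to
  one representing \<open>y\<close>.\<close>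

lemma cosimple_projection:
  assumes u: "cosimple d n u" and P: "P \<in> carrier_mat m d" and Q: "Q \<in> carrier_mat d m"
    and PQ: "P * Q = 1\<^sub>m m"
  shows "cosimple m n (\<lambda>i. P *\<^sub>v u i)"
proof -
  have carr: "u \<in> {..<n} \<rightarrow> carrier_vec d" using u by (auto simp: cosimple_iff)
  note image = combination_mult_mat_vec[OF carr P, symmetric]
  have PQ': "real_of_int_mat P * real_of_int_mat Q = 1\<^sub>m m"
    using P Q PQ of_int_hom.mat_hom_mult[of P m d Q m, symmetric] by (simp add: of_int_hom.mat_hom_one)
  have "\<exists>t. y = combination m n (\<lambda>i. P *\<^sub>v u i) t" if y: "y \<in> carrier_vec m" for y
  proof -
    obtain t where "real_of_int_mat Q *\<^sub>v y = combination d n u t"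
      using u y Q unfolding cosimple_iff by (metis map_carrier_mat mult_mat_vec_carrier)
    then have "y = combination m n (\<lambda>i. P *\<^sub>v u i) t"
      using mult_right_inverse[of "real_of_int_mat P" m d "real_of_int_mat Q" y] P Q PQ' y image
      by auto
    then show ?thesis by blast
  qed
  moreover obtain c where "combination d n u c = 0\<^sub>v d"
    and c: "\<forall>i<n. c i \<noteq> 0" "\<forall>i<n. \<forall>j<n. i \<noteq> j \<longrightarrow> \<bar>c i\<bar> \<noteq> \<bar>c j\<bar>"
    using u by (auto simp: cosimple_iff)
  then have "combination m n (\<lambda>i. P *\<^sub>v u i) c = 0\<^sub>v m" using image[of c] P by auto
  moreover have "\<forall>i<n. P *\<^sub>v u i \<in> carrier_vec m"
    using carr by (auto intro!: mult_mat_vec_carrier[OF P])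
  ultimately show ?thesis using c unfolding cosimple_iff by blast
qed

section \<open>Lattice coverings by dilated zonotopes and the covering radius\<close>

lemma zonotope_eq:
  "zonotope d n u = {combination d n u t | t. \<forall>i<n. 0 \<le> t i \<and> t i \<le> 1}"
  by (simp add: zonotope_def combination_def)

text \<open>The condition under the infimum in \<open>covering_radius\<close>, apart from positivity
  of \<open>\<rho>\<close>.\<close>

definition lattice_covering :: "nat \<Rightarrow> real vec set \<Rightarrow> real \<Rightarrow> bool" where
  "lattice_covering d M \<rho> \<longleftrightarrow>
     {\<rho> \<cdot>\<^sub>v x + z | x z. x \<in> M \<and> z \<in> integer_points d} = carrier_vec d"

lemma lattice_covering_zonotope_iff:
  assumes u: "u \<in> {..<n} \<rightarrow> carrier_vec d"
  shows "lattice_covering d (zonotope d n u) \<rho> \<longleftrightarrow>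
    (\<forall>y \<in> carrier_vec d. \<exists>t. (\<forall>i<n. 0 \<le> t i \<and> t i \<le> 1) \<and>
       (\<exists>z \<in> carrier_vec d. y = combination d n u (\<lambda>i. \<rho> * t i) + real_of_int_vec z))"
    (is "_ \<longleftrightarrow> ?R")
proof -
  let ?S = "{combination d n u (\<lambda>i. \<rho> * t i) + real_of_int_vec z | t z.
       (\<forall>i<n. 0 \<le> t i \<and> t i \<le> 1) \<and> z \<in> carrier_vec d}"
  have eq: "{\<rho> \<cdot>\<^sub>v x + z | x z. x \<in> zonotope d n u \<and> z \<in> integer_points d} = ?S"
    unfolding zonotope_eq integer_points_def combination_smult[OF u, symmetric] by blast
  have sub: "?S \<subseteq> carrier_vec d" using combination_carrier[OF u] by auto
  have "lattice_covering d (zonotope d n u) \<rho> \<longleftrightarrow> carrier_vec d \<subseteq> ?S"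
    unfolding lattice_covering_def eq by (rule iffI[OF equalityD2 subset_antisym[OF sub]])
  also have "\<dots> \<longleftrightarrow> ?R" by (simp only: subset_iff mem_Collect_eq Bex_def Ball_def) metis
  finally show ?thesis .
qed

text \<open>The zonotope is convex and contains the origin, so its dilates are nested: a coefficient
  \<open>t i\<close> at scale \<open>\<rho>\<close> becomes \<open>\<rho> / \<sigma> * t i\<close>
  at scale \<open>\<sigma>\<close>.\<close>

lemma lattice_covering_zonotope_mono:
  assumes u: "u \<in> {..<n} \<rightarrow> carrier_vec d"
    and cov: "lattice_covering d (zonotope d n u) \<rho>" and le: "0 < \<rho>" "\<rho> \<le> \<sigma>"
  shows "lattice_covering d (zonotope d n u) \<sigma>"
  unfolding lattice_covering_zonotope_iff[OF u]
proof
  fix y :: "real vec" assume "y \<in> carrier_vec d"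
  then obtain t z where t: "\<forall>i<n. 0 \<le> t i \<and> t i \<le> 1" and z: "z \<in> carrier_vec d"
    and y: "y = combination d n u (\<lambda>i. \<rho> * t i) + real_of_int_vec z"
    using cov unfolding lattice_covering_zonotope_iff[OF u] by blast
  have "(\<lambda>i. \<rho> * t i) = (\<lambda>i. \<sigma> * (\<rho> / \<sigma> * t i))" using le by auto
  moreover have "\<forall>i<n. 0 \<le> \<rho> / \<sigma> * t i \<and> \<rho> / \<sigma> * t i \<le> 1"
    using t le by (auto intro!: mult_le_one simp del: times_divide_eq_left)
  ultimately show "\<exists>t. (\<forall>i<n. 0 \<le> t i \<and> t i \<le> 1) \<and>
       (\<exists>z \<in> carrier_vec d. y = combination d n u (\<lambda>i. \<sigma> * t i) + real_of_int_vec z)"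
    using y z by (intro exI[of _ "\<lambda>i. \<rho> / \<sigma> * t i"]) auto
qed

text \<open>Write a point as a combination of the generators and split each coefficient: the
  fractional parts give a point of the zonotope, the floors an integer vector. This shows that the
  infimum defining the covering radius is over a nonempty set.\<close>

lemma lattice_covering_cosimple:
  assumes u: "cosimple d n u"
  shows "lattice_covering d (zonotope d n u) 1"
proof -
  have carr: "u \<in> {..<n} \<rightarrow> carrier_vec d" using u by (auto simp: cosimple_iff)
  show ?thesis
    unfolding lattice_covering_zonotope_iff[OF carr]
  proof
    fix y :: "real vec" assume y: "y \<in> carrier_vec d"
    then obtain t where t: "y = combination d n u t" using u by (auto simp: cosimple_iff)
    define z where "z = vec d (\<lambda>j. \<Sum>i<n. \<lfloor>t i\<rfloor> * u i $ j)"
    have "y = combination d n u (\<lambda>i. 1 * frac (t i)) + real_of_int_vec z"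
      using y carrier_vecD[OF combination_carrier[OF carr]]
      by (intro eq_vecI)
        (auto simp: t z_def combination_index[OF carr] frac_def sum.distrib[symmetric] algebra_simps)
    then show "\<exists>t. (\<forall>i<n. 0 \<le> t i \<and> t i \<le> 1) \<and>
       (\<exists>z \<in> carrier_vec d. y = combination d n u (\<lambda>i. 1 * t i) + real_of_int_vec z)"
      by (intro exI[of _ "\<lambda>i. frac (t i)"])
        (auto simp: z_def less_imp_le[OF frac_lt_1] intro!: bexI[of _ z])
  qed
qed

lemma covering_radius_le:
  assumes "0 < \<rho>" "lattice_covering d M \<rho>"
  shows "covering_radius d M \<le> \<rho>"
  unfolding covering_radius_def
  by (rule cInf_lower) (use assms in \<open>auto simp: lattice_covering_def intro!: bdd_belowI[of _ 0]\<close>)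

text \<open>Some covering scale lies strictly below \<open>\<rho>\<close>, and monotonicity carries
  it up to \<open>\<rho>\<close>. The strict inequality avoids any question of attainment, which
  fails in dimension 0.\<close>

lemma lattice_covering_above_covering_radius:
  assumes u: "cosimple d n u" and lt: "covering_radius d (zonotope d n u) < \<rho>"
  shows "lattice_covering d (zonotope d n u) \<rho>"
proof -
  let ?C = "{\<rho>. 0 < \<rho> \<and> lattice_covering d (zonotope d n u) \<rho>}"
  have "1 \<in> ?C" using lattice_covering_cosimple[OF u] by simp
  then have "?C \<noteq> {}" by blast
  moreover have "Inf ?C < \<rho>" using lt by (simp add: covering_radius_def lattice_covering_def)
  ultimately have "\<exists>\<sigma>\<in>?C. \<sigma> < \<rho>" by (rule cInf_lessD)
  then obtain \<sigma> where "0 < \<sigma>" "lattice_covering d (zonotope d n u) \<sigma>" "\<sigma> < \<rho>" by auto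
  then show ?thesis
    using lattice_covering_zonotope_mono[of u n d \<sigma> \<rho>] u by (auto simp: cosimple_iff)
qed

text \<open>A copy of the projected zonotope scaled by \<open>\<rho>\<close> fixes a point up to the
  lattice and a multiple of \<open>w\<close>; the segment from \<open>a / N\<close> to
  \<open>a / N + w\<close> inside the zonotope scaled by \<open>1 / N\<close> absorbs that multiple
  modulo \<open>w\<close>. By convexity the two scales add up.\<close>

lemma lattice_covering_from_projection:
  assumes u: "u \<in> {..<n} \<rightarrow> carrier_vec d"
    and P: "P \<in> carrier_mat m d" and Q: "Q \<in> carrier_mat d m" and PQ: "P * Q = 1\<^sub>m m"
    and w: "w \<in> carrier_vec d"
    and ker: "\<And>x. x \<in> carrier_vec d \<Longrightarrow> real_of_int_mat P *\<^sub>v x = 0\<^sub>v m \<Longrightarrow>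
       \<exists>s. x = s \<cdot>\<^sub>v real_of_int_vec w"
    and seg: "a \<in> zonotope d n u" "a + N \<cdot>\<^sub>v real_of_int_vec w \<in> zonotope d n u"
    and pos: "0 < N" "0 < \<rho>"
    and cov: "lattice_covering m (zonotope m n (\<lambda>i. P *\<^sub>v u i)) \<rho>"
  shows "lattice_covering d (zonotope d n u) (\<rho> + 1 / N)"
  unfolding lattice_covering_zonotope_iff[OF u]
proof
  let ?P = "real_of_int_mat P"
  fix x :: "real vec" assume x: "x \<in> carrier_vec d"
  obtain ta where ta: "\<forall>i<n. 0 \<le> ta i \<and> ta i \<le> 1" and a: "a = combination d n u ta"
    using seg by (auto simp: zonotope_eq)
  obtain tb where tb: "\<forall>i<n. 0 \<le> tb i \<and> tb i \<le> 1"
    and b: "a + N \<cdot>\<^sub>v real_of_int_vec w = combination d n u tb"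
    using seg by (auto simp: zonotope_eq)
  have Pu: "(\<lambda>i. P *\<^sub>v u i) \<in> {..<n} \<rightarrow> carrier_vec m" using P u by (auto intro!: mult_mat_vec_carrier[OF P])
  have cc: "combination d n u t \<in> carrier_vec d" for t using combination_carrier[OF u] .
  \<comment> \<open>Subtracting \<open>a / N\<close> reserves the start of the short segment in
    direction \<open>w\<close>.\<close>
  define y where "y = x - (1 / N) \<cdot>\<^sub>v a"
  have yc: "y \<in> carrier_vec d" using x a cc by (auto simp: y_def)
  have "?P *\<^sub>v y \<in> carrier_vec m" using P yc by auto
  then obtain s z where s: "\<forall>i<n. 0 \<le> s i \<and> s i \<le> 1" and z: "z \<in> carrier_vec m"
    and Py: "?P *\<^sub>v y = combination m n (\<lambda>i. P *\<^sub>v u i) (\<lambda>i. \<rho> * s i) + real_of_int_vec z"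
    using cov unfolding lattice_covering_zonotope_iff[OF Pu] by blast
  \<comment> \<open>Lifts of the two summands of the projected point: \<open>Q\<close> lifts the
    integer vector, and the same coefficients on the original generators lift the zonotope point.
    The error \<open>r\<close> therefore lies in the kernel of \<open>P\<close>.\<close>
  let ?z = "Q *\<^sub>v z" and ?c = "combination d n u (\<lambda>i. \<rho> * s i)"
  have zc: "?z \<in> carrier_vec d" using Q z by auto
  have Pz: "?P *\<^sub>v real_of_int_vec ?z = real_of_int_vec z"
    using of_int_hom.mult_mat_vec_hom[OF P zc, symmetric] mult_right_inverse[OF P Q PQ z] by simp
  define r where "r = y - (?c + real_of_int_vec ?z)"
  have rc: "r \<in> carrier_vec d" using yc cc zc by (auto simp: r_def)
  have "?P *\<^sub>v r = ?P *\<^sub>v y - (?P *\<^sub>v ?c + ?P *\<^sub>v real_of_int_vec ?z)"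
    unfolding r_def using P yc cc zc
    by (simp add: mult_minus_distrib_mat_vec[of _ m d] mult_add_distrib_mat_vec[of _ m d])
  also have "\<dots> = 0\<^sub>v m"
    unfolding Py Pz combination_mult_mat_vec[OF u P]
    using combination_carrier[OF Pu] z by (intro minus_cancel_vec) auto
  finally obtain \<sigma> where \<sigma>: "r = \<sigma> \<cdot>\<^sub>v real_of_int_vec w" using ker[OF rc] by blast
  \<comment> \<open>The floor of \<open>\<sigma>\<close> is absorbed by the lattice as a multiple of
    \<open>w\<close>; the fractional part is a position along the segment.\<close>
  define \<tau> where "\<tau> = frac \<sigma>"
  have \<tau>: "0 \<le> \<tau>" "\<tau> \<le> 1" by (auto simp: \<tau>_def less_imp_le[OF frac_lt_1])
  \<comment> \<open>The mean of \<open>s\<close>, with weight \<open>\<rho>\<close>, and of the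
    coefficients of the segment point at \<open>\<tau>\<close>, with weight \<open>1 / N\<close>; as
    a mean of numbers in [0, 1] it stays there.\<close>
  define c where "c = (\<lambda>i. (\<rho> * s i + (1 / N) * ((1 - \<tau>) * ta i + \<tau> * tb i)) / (\<rho> + 1 / N))"
  have "0 < \<rho> + 1 / N" using pos by (simp add: add_pos_pos)
  have c01: "0 \<le> c i \<and> c i \<le> 1" if "i < n" for i
  proof -
    have "0 \<le> (1 - \<tau>) * ta i + \<tau> * tb i" using \<tau> ta tb that by simp
    moreover have "(1 - \<tau>) * ta i + \<tau> * tb i \<le> (1 - \<tau>) * 1 + \<tau> * 1"
      using \<tau> ta tb that by (intro add_mono mult_left_mono) auto
    moreover have "\<rho> * s i \<le> \<rho> * 1" "0 \<le> \<rho> * s i" using s pos that by auto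
    ultimately show ?thesis
      unfolding c_def using pos \<open>0 < \<rho> + 1 / N\<close>
      by (auto simp: divide_le_eq_1 intro!: divide_nonneg_pos add_nonneg_nonneg add_mono divide_right_mono)
  qed
  have ce: "(\<rho> + 1 / N) * c i = \<rho> * s i + (1 / N) * ((1 - \<tau>) * ta i + \<tau> * tb i)" for i
    using \<open>0 < \<rho> + 1 / N\<close> by (simp add: c_def)
  have "x = combination d n u (\<lambda>i. (\<rho> + 1 / N) * c i) + real_of_int_vec (?z + \<lfloor>\<sigma>\<rfloor> \<cdot>\<^sub>v w)"
  proof (rule eq_vecI)
    fix j assume "j < dim_vec (combination d n u (\<lambda>i. (\<rho> + 1 / N) * c i) + real_of_int_vec (?z + \<lfloor>\<sigma>\<rfloor> \<cdot>\<^sub>v w))"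
    then have j: "j < d" using w zc cc by auto
    note dims = carrier_vecD[OF cc] carrier_vecD[OF zc] carrier_vecD[OF w] carrier_vecD[OF x] carrier_vecD[OF yc] j
    have "r $ j = \<sigma> * w $ j" using \<sigma> dims by simp
    then have xj: "x $ j = combination d n u ta $ j / N + ?c $ j + ?z $ j + \<sigma> * w $ j"
      using dims Q by (simp add: r_def y_def a)
    have bj: "combination d n u tb $ j = combination d n u ta $ j + N * w $ j"
      using arg_cong[OF b, of "\<lambda>v. v $ j"] dims by (simp add: a)
    have "combination d n u (\<lambda>i. (\<rho> + 1 / N) * c i) $ j =
        ?c $ j + (1 / N) * ((1 - \<tau>) * combination d n u ta $ j + \<tau> * combination d n u tb $ j)"
      unfolding ce using j
      by (simp add: combination_index[OF u] sum_distrib_left sum.distrib[symmetric] algebra_simps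
          flip: sum_divide_distrib)
    \<comment> \<open>The far endpoint is \<open>a + N w\<close>, so the segment point at
      \<open>\<tau>\<close>, divided by \<open>N\<close>, is
      \<open>a / N + \<tau> w\<close>.\<close>
    also have "\<dots> = ?c $ j + combination d n u ta $ j / N + \<tau> * w $ j"
      unfolding bj using pos by (simp add: field_simps)
    finally show "x $ j = (combination d n u (\<lambda>i. (\<rho> + 1 / N) * c i) +
        real_of_int_vec (?z + \<lfloor>\<sigma>\<rfloor> \<cdot>\<^sub>v w)) $ j"
      using dims Q by (simp add: xj \<tau>_def frac_def algebra_simps)
  qed (use x w zc cc in auto)
  with c01 w zc show "\<exists>t. (\<forall>i<n. 0 \<le> t i \<and> t i \<le> 1) \<and> (\<exists>z \<in> carrier_vec d.
      x = combination d n u (\<lambda>i. (\<rho> + 1 / N) * t i) + real_of_int_vec z)"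
    by (intro exI[of _ c]) auto
qed

section \<open>Pigeonhole modulo \<open>N\<close> and the bound on lattice points\<close>

lemma congruent_integer_points:
  assumes S: "finite S" "S \<subseteq> integer_points d" and card: "N ^ d < card S" and N: "0 < N"
  obtains a w where "a \<in> S" "a + real N \<cdot>\<^sub>v real_of_int_vec w \<in> S" "w \<in> carrier_vec d" "w \<noteq> 0\<^sub>v d"
proof -
  \<comment> \<open>Coordinatewise residues; the floor only turns the real coordinates of an integer
    point back into integers. Restricting to \<open>{..<d}\<close> places the values in a function
    space with \<open>N ^ d\<close> elements, so two points of \<open>S\<close> share their
    residues.\<close>
  define f where "f x = restrict (\<lambda>j. \<lfloor>x $ j\<rfloor> mod int N) {..<d}" for x :: "real vec"
  let ?F = "PiE {..<d} (\<lambda>_. {0..<int N})"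
  have "f x \<in> ?F" for x unfolding f_def restrict_PiE_iff using N by simp
  then have "card (f ` S) \<le> card ?F" by (intro card_mono finite_PiE image_subsetI) auto
  also have "card ?F = N ^ d" by (simp add: card_PiE)
  finally have "\<not> inj_on f S" using card card_image[of f S] by auto
  then obtain a b where ab: "a \<in> S" "b \<in> S" "a \<noteq> b" "f a = f b" by (auto simp: inj_on_def)
  have "a \<in> integer_points d" "b \<in> integer_points d" using ab S by auto
  then obtain a' b' where a': "a' \<in> carrier_vec d" "a = real_of_int_vec a'"
    and b': "b' \<in> carrier_vec d" "b = real_of_int_vec b'"
    unfolding integer_points_def by (elim imageE)
  define w where "w = vec d (\<lambda>j. (b' $ j - a' $ j) div int N)"
  have "int N * w $ j = b' $ j - a' $ j" if j: "j < d" for j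
  proof -
    have "a' $ j mod int N = b' $ j mod int N"
      using fun_cong[OF ab(4), of j] j a' b' by (simp add: f_def)
    then have "int N dvd b' $ j - a' $ j" by (metis mod_eq_dvd_iff)
    then show ?thesis using j by (simp add: w_def)
  qed
  then have "real N * w $ j = b' $ j - a' $ j" if "j < d" for j
    using that by (metis of_int_diff of_int_mult of_int_of_nat_eq)
  then have e: "a + real N \<cdot>\<^sub>v real_of_int_vec w = b"
    using a' b' by (intro eq_vecI) (auto simp: w_def)
  then have "w \<noteq> 0\<^sub>v d" using ab a' by auto
  with e ab show thesis by (intro that[of a w]) (auto simp: w_def)
qed

text \<open>An infinite set would have a subset of \<open>k + 1\<close> elements. Finiteness and the
  bound thus come together, and the pigeonhole argument is applied to finite sets only.\<close>

lemma card_le_of_finite_subsets: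
  assumes "\<And>S. finite S \<Longrightarrow> S \<subseteq> A \<Longrightarrow> card S \<le> k"
  shows "finite A \<and> card A \<le> k"
proof -
  have "finite A"
  proof (rule ccontr)
    assume "infinite A"
    then obtain S where "finite S" "S \<subseteq> A" "card S = Suc k"
      using infinite_arbitrarily_large by metis
    with assms show False by fastforce
  qed
  with assms show ?thesis by blast
qed

theorem theorem3:
  fixes d :: nat
  assumes "d \<ge> 1"
    and "\<forall>Z. cosimple_zonotope (d - 1) Z \<longrightarrow>
           covering_radius (d - 1) Z \<le> (real d - 1) / (real d + 1)"
  shows "\<forall>Z. cosimple_zonotope d Z \<and> covering_radius d Z > real d / (real d + 2) \<longrightarrow>
           finite (Z \<inter> integer_points d) \<and>
           card (Z \<inter> integer_points d) \<le> ((d + 2) choose 2) ^ d"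
proof (intro allI impI)
  fix Z assume Z: "cosimple_zonotope d Z \<and> covering_radius d Z > real d / (real d + 2)"
  then obtain n u where u: "cosimple d n u" and Zu: "Z = zonotope d n u"
    by (auto simp: cosimple_zonotope_def)
  have carr: "u \<in> {..<n} \<rightarrow> carrier_vec d" using u by (auto simp: cosimple_iff)
  obtain m where m: "d = Suc m" using assms(1) by (cases d) auto
  \<comment> \<open>Since \<open>d (d + 1) - (d - 1) (d + 2) = 2\<close>, the gap between
    \<open>d / (d + 2)\<close> and \<open>(d - 1) / (d + 1)\<close> is
    \<open>2 / ((d + 1) (d + 2))\<close>, which is exactly \<open>1 / N\<close>.\<close>
  define N where "N = (d + 2) choose 2"
  have N: "0 < N" by (simp add: N_def)
  have "2 * N = (d + 2) * (d + 1)" unfolding N_def by (simp add: choose_two)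
  then have "2 * real N = (real d + 2) * (real d + 1)"
    by (metis of_nat_add of_nat_mult of_nat_numeral of_nat_1)
  then have "1 / real N = 2 / ((real d + 2) * (real d + 1))"
    using N by (simp add: field_simps)
  then have radii: "(real d - 1) / (real d + 1) + 1 / real N = real d / (real d + 2)"
    by (simp only:) (simp add: divide_simps, simp add: algebra_simps)
  show "finite (Z \<inter> integer_points d) \<and> card (Z \<inter> integer_points d) \<le> ((d + 2) choose 2) ^ d"
  proof (rule card_le_of_finite_subsets, rule ccontr)
    fix S assume S: "finite S" "S \<subseteq> Z \<inter> integer_points d"
      and big: "\<not> card S \<le> ((d + 2) choose 2) ^ d"
    have "N ^ d < card S" using big by (simp add: N_def)
    then obtain a w where aw: "a \<in> S" "a + real N \<cdot>\<^sub>v real_of_int_vec w \<in> S"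
      and w: "w \<in> carrier_vec d" "w \<noteq> 0\<^sub>v d"
      using congruent_integer_points[of S d N] S N by auto
    obtain P Q where PQ: "P \<in> carrier_mat m d" "Q \<in> carrier_mat d m" "P * Q = 1\<^sub>m m"
      and ker: "\<And>x. x \<in> carrier_vec d \<Longrightarrow> real_of_int_mat P *\<^sub>v x = 0\<^sub>v m \<Longrightarrow>
         \<exists>s. x = s \<cdot>\<^sub>v real_of_int_vec w"
      using projection_along_integer_vector[of w m] w unfolding m by metis
    let ?u = "\<lambda>i. P *\<^sub>v u i"
    have Pu: "cosimple m n ?u" by (rule cosimple_projection[OF u PQ])
    then have le: "covering_radius m (zonotope m n ?u) \<le> (real d - 1) / (real d + 1)"
      using assms(2) m by (auto simp: cosimple_zonotope_def)
    \<comment> \<open>Coverings of the projection are known only strictly above its covering radius,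
      so the estimate is proved for every \<open>\<rho>\<close> above the bound and
      \<open>\<rho>\<close> is then lowered to it by \<open>dense_ge\<close>. This also keeps
      \<open>\<rho>\<close> positive when \<open>d = 1\<close> and the bound is 0.\<close>
    have "covering_radius d Z \<le> (\<rho> + 1 / N)" if \<rho>: "(real d - 1) / (real d + 1) < \<rho>" for \<rho>
    proof (rule covering_radius_le)
      have "0 \<le> (real d - 1) / (real d + 1)" using assms(1) by simp
      then have "0 < \<rho>" using \<rho> by linarith
      then show "0 < \<rho> + 1 / N" using N by (simp add: add_pos_nonneg)
      show "lattice_covering d Z (\<rho> + 1 / N)"
        unfolding Zu
        by (rule lattice_covering_from_projection[OF carr PQ w(1) ker _ _ _ \<open>0 < \<rho>\<close>, of a])
          (use aw S N \<rho> le lattice_covering_above_covering_radius[OF Pu] in \<open>auto simp: Zu\<close>)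
    qed
    then have "covering_radius d Z - 1 / N \<le> \<rho>" if "(real d - 1) / (real d + 1) < \<rho>" for \<rho>
      using that by (simp add: diff_le_eq)
    then have "covering_radius d Z - 1 / N \<le> (real d - 1) / (real d + 1)"
      by (rule dense_ge)
    with Z radii show False by linarith
  qed
qed

end
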